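(* Let $d,D,n\ge1$ be integers, $q\ge 1$, $L_{\mathcal H},L_{\mathcal G}>0$, let $X_1,\ldots,X_n\in[0,1]^D$, let $\mathcal H\subseteq \mathrm{Lip}_{L_{\mathcal H}}([0,1]^D\to[0,1]^d)$ and $\mathcal G\subseteq\mathrm{Lip}_{L_{\mathcal G}}([0,1]^d\to[0,1]^D)$. For any $\lambda>0$ and $\varepsilon>0$, let $\hat g_{n,\varepsilon}\in\mathcal G$ be any element satisfying $$\mathsf W_1(\hat g_{n,\varepsilon}\sharp\,\mathcal U_d,P_{n,X})+\lambda\,\mathrm{pen}_{\mathcal H}(\hat g_{n,\varepsilon})\le\min_{g\in\mathcal G}\Bigl\{\mathsf W_1(g\sharp\,\mathcal U_d,P_{n,X})+\lambda\,\mathrm{pen}_{\mathcal H}(g)\Bigr\}+\varepsilon .$$ Then $$\mathsf W_1(\hat g_{n,\varepsilon}\sharp\,\mathcal U_d,P_{n,X})\;\ge\;\frac{1}{2L_{\mathcal H}\bigl(1+(2\mathsf V_d n)^{1/d}\bigr)}-\frac{1}{L_{\mathcal H}\lambda^{1/q}}\Bigl(\inf_{g\in\mathcal G_{\mathcal H}}\mathsf W_1(g\sharp\,\mathcal U_d,P_{n,X})+\varepsilon\Bigr)^{1/q},$$ where $\mathcal G_{\mathcal H}=\{g\in\mathcal G:\mathrm{pen}_{\mathcal H}(g)=0\}$.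
   Context: $\|\cdot\|$ is the Euclidean norm. $\mathrm{Lip}_L(A\to B)$ is the set of functions $f:A\to B$ with $\|f(x)-f(x')\|\le L\|x-x'\|$ for all $x,x'\in A$. $\mathcal U_d$ is the uniform distribution on $[0,1]^d$; $g\sharp\,\mathcal U_d$ is the push-forward of $\mathcal U_d$ by $g$; $P_{n,X}=\frac1n\sum_{i=1}^n\delta_{X_i}$ is the empirical distribution. $\mathsf W_1$ is the Wasserstein-1 distance, $\mathsf W_1(P,Q)=\sup_f|\mathbb E_P[f(X)]-\mathbb E_Q[f(X)]|$ over all 1-Lipschitz-continuous $f$. $\mathsf V_d=\pi^{d/2}/\Gamma(1+d/2)$ is the volume of the unit ball of $\mathbb R^d$. The left inverse penalty is $$\mathrm{pen}_{\mathcal H}(g)=\min_{h\in\mathcal H}\int_{[0,1]^d}\|h(g(u))-u\|^q\,du .$$ The minima written are understood to exist. The infimum over an empty set is $+\infty$. *)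

theory Defs
  imports "HOL-Probability.Probability"
begin

definition unit_cube :: "(real ^ 'k) set" where
  "unit_cube = cbox 0 1"

text \<open>Maps \<open>A \<rightarrow> B\<close> are total functions of which only the values on \<open>A\<close> matter; every notion
  below evaluates them on \<open>A\<close> only.\<close>

definition Lip :: "real \<Rightarrow> 'a::metric_space set \<Rightarrow> 'b::metric_space set \<Rightarrow> ('a \<Rightarrow> 'b) set" where
  "Lip L A B = {f \<in> A \<rightarrow> B. L-lipschitz_on A f}"

text \<open>The cube has volume one, so no normalisation is needed. The underlying space is restricted to
  the cube, so that maps which are only continuous there can be pushed forward.\<close>

definition uniform_cube :: "(real ^ 'k) measure" where
  "uniform_cube = restrict_space lborel unit_cube"

definition push_forward ::
    "('a \<Rightarrow> 'b::topological_space) \<Rightarrow> 'a measure \<Rightarrow> 'b measure" where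
  "push_forward g M = distr M borel g"

text \<open>The points are \<open>X 1, \<dots>, X n\<close>, possibly with repetitions; see \<open>emeasure_empirical\<close>
  for the description as the average of the Dirac measures.\<close>

definition empirical :: "nat \<Rightarrow> (nat \<Rightarrow> 'a::topological_space) \<Rightarrow> 'a measure" where
  "empirical n X = distr (uniform_count_measure {1..n}) borel X"

text \<open>Meant for probability measures with finite first moment, for which every Lipschitz function is
  integrable (the integral of a non-integrable function is \<open>0\<close> by convention).\<close>

definition wasserstein1 :: "'a::metric_space measure \<Rightarrow> 'a measure \<Rightarrow> ereal" where
  "wasserstein1 P Q =
     (SUP f \<in> {f :: 'a \<Rightarrow> real. 1-lipschitz_on UNIV f}.
        ereal \<bar>(\<integral>x. f x \<partial>P) - (\<integral>x. f x \<partial>Q)\<bar>)"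

definition inverse_loss ::
    "real \<Rightarrow> (real ^ 'd \<Rightarrow> real ^ 'D) \<Rightarrow> (real ^ 'D \<Rightarrow> real ^ 'd) \<Rightarrow> real" where
  "inverse_loss q g h = (LINT u:unit_cube|lborel. norm (h (g u) - u) powr q)"

definition has_minimum :: "('a \<Rightarrow> 'b::order) \<Rightarrow> 'a set \<Rightarrow> bool" where
  "has_minimum f S \<longleftrightarrow> (\<exists>x\<in>S. \<forall>y\<in>S. f x \<le> f y)"

text \<open>This is the minimum whenever \<open>has_minimum (inverse_loss q g) H\<close>.\<close>

definition pen :: "real \<Rightarrow> (real ^ 'D \<Rightarrow> real ^ 'd) set \<Rightarrow> (real ^ 'd \<Rightarrow> real ^ 'D) \<Rightarrow> real" where
  "pen q H g = (INF h\<in>H. inverse_loss q g h)"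

definition objective ::
    "real \<Rightarrow> real \<Rightarrow> (real ^ 'D \<Rightarrow> real ^ 'd) set \<Rightarrow> (real ^ 'D) measure
      \<Rightarrow> (real ^ 'd \<Rightarrow> real ^ 'D) \<Rightarrow> ereal" where
  "objective q lam H P g =
     wasserstein1 (push_forward g uniform_cube) P + ereal (lam * pen q H g)"

text \<open>Real powers with positive exponent of nonnegative extended reals; the values at
  negative arguments are irrelevant.\<close>

definition ereal_powr :: "ereal \<Rightarrow> real \<Rightarrow> ereal" where
  "ereal_powr x a = (if x = \<infinity> then \<infinity> else ereal (real_of_ereal x powr a))"

lemma emeasure_empirical:
  assumes "n \<ge> 1" "A \<in> sets borel"
  shows "emeasure (empirical n X) A = (\<Sum>i=1..n. emeasure (return borel (X i)) A) / of_nat n"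
proof -
  have X: "X \<in> measurable (uniform_count_measure {1..n}) borel"
    by (simp add: measurable_def space_uniform_count_measure sets_uniform_count_measure)
  have "emeasure (empirical n X) A = ennreal (card {i \<in> {1..n}. X i \<in> A} / n)"
    using assms X unfolding empirical_def
    by (subst emeasure_distr)
       (auto simp: space_uniform_count_measure emeasure_uniform_count_measure
         intro!: arg_cong[where f = card] arg_cong2[where f = "\<lambda>a b. ennreal (a / b)"])
  also have "\<dots> = of_nat (card {i \<in> {1..n}. X i \<in> A}) / of_nat n"
    using assms by (simp add: divide_ennreal[symmetric] ennreal_of_nat_eq_real_of_nat)
  also have "of_nat (card {i \<in> {1..n}. X i \<in> A}) = (\<Sum>i=1..n. emeasure (return borel (X i)) A)"
    using assms by (simp add: indicator_def if_distrib sum.If_cases Int_def conj_commute)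
  finally show ?thesis .
qed

lemma prob_space_uniform_cube: "prob_space (uniform_cube :: (real ^ 'k) measure)"
proof
  have "emeasure lborel (cbox 0 1 :: (real ^ 'k) set) = 1"
    by (subst emeasure_lborel_cbox)
       (auto simp: Basis_vec_def inner_axis intro!: prod.neutral)
  then show "emeasure (uniform_cube :: (real ^ 'k) measure) (space uniform_cube) = 1"
    by (simp add: uniform_cube_def unit_cube_def emeasure_restrict_space)
qed

lemma Lip_measurable_uniform_cube:
  fixes g :: "real ^ 'd \<Rightarrow> 'b::metric_space"
  assumes "g \<in> Lip L unit_cube B"
  shows "g \<in> measurable uniform_cube borel"
proof -
  have "continuous_on unit_cube g"
    using assms by (auto simp: Lip_def intro: lipschitz_on_continuous_on)
  then have "g \<in> measurable (restrict_space borel unit_cube) borel"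
    by (rule borel_measurable_continuous_on_restrict)
  then show ?thesis
    by (simp add: uniform_cube_def cong: measurable_cong_sets sets_restrict_space_cong)
qed

end

theory Submission
  imports Defs
begin

text \<open>
  Why the bound holds. Write \<open>U\<close> for the uniform distribution on the cube, \<open>E\<close> for the
  empirical distribution and \<open>S = {X 1, \<dots>, X n}\<close> for its support. The distance to \<open>S\<close> is
  1-Lipschitz and vanishes \<open>E\<close>-almost surely, so it is a test function showing that the
  Wasserstein distance between \<open>g\<sharp>U\<close> and \<open>E\<close> is at least the mean distance from
  \<open>g u\<close> to \<open>S\<close> (\<open>wasserstein1_empirical_ge\<close>). A candidate \<open>h\<close> for the left inverse of \<open>g\<close>
  with Lipschitz constant \<open>L\<close> stretches distances at most by the factor \<open>L\<close>, so this mean distance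
  is at least \<open>1/L\<close> times the mean distance from \<open>h (g u)\<close> to the at most \<open>n\<close> points \<open>h ` S\<close>.
  Up to the mean reconstruction error \<open>\<integral> \<parallel>h (g u) - u\<parallel> du\<close> one may replace \<open>h (g u)\<close> by \<open>u\<close>.

  Two facts finish the argument. First, \<open>n\<close> points cannot quantize the cube well: the balls of
  radius \<open>(2 V n) powr (-1/d)\<close> around them cover at most half of the volume
  (\<open>quantization_error_unit_cube\<close>). Second, the reconstruction error is bounded by the penalty to the
  power \<open>1/q\<close> (\<open>expectation_le_powr_mean\<close>), and the penalty of a near-minimizer is small,
  since it competes with all generators of zero penalty.
\<close>

section \<open>Comparison of moments\<close>

text \<open>The \<open>L\<^sup>1\<close> norm is at most the \<open>L\<^sup>q\<close> norm: with \<open>m\<close> the mean of \<open>f\<close>, integrate Young's inequality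
  for \<open>f x powr q\<close> and \<open>m powr q\<close> with weights \<open>1/q\<close> and \<open>1 - 1/q\<close>.\<close>

lemma (in prob_space) expectation_le_powr_mean:
  fixes f :: "'a \<Rightarrow> real"
  assumes q: "q \<ge> 1" and nonneg: "\<And>x. f x \<ge> 0"
    and f: "integrable M f" and fq: "integrable M (\<lambda>x. f x powr q)"
  shows "expectation f \<le> expectation (\<lambda>x. f x powr q) powr (1 / q)"
proof -
  define m where "m = expectation f"
  have m: "m \<ge> 0"
    unfolding m_def using nonneg by simp
  have young: "f x * m powr (q - 1) \<le> 1 / q * f x powr q + (1 - 1 / q) * m powr q" for x
  proof (cases "f x = 0 \<or> m = 0")
    case True
    then show ?thesis
      using q by auto
  next
    case False
    have "(f x powr q) powr (1 / q) * (m powr q) powr (1 - 1 / q)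
        \<le> 1 / q * f x powr q + (1 - 1 / q) * m powr q"
      using q False by (intro Youngs_inequality_0) auto
    also have "(f x powr q) powr (1 / q) = f x"
      using q nonneg by (simp add: powr_powr)
    also have "(m powr q) powr (1 - 1 / q) = m powr (q - 1)"
      using q by (simp add: powr_powr algebra_simps)
    finally show ?thesis .
  qed
  have "m * m powr (q - 1) = expectation (\<lambda>x. f x * m powr (q - 1))"
    by (simp add: m_def)
  also have "\<dots> \<le> expectation (\<lambda>x. 1 / q * f x powr q + (1 - 1 / q) * m powr q)"
    using f fq young by (intro integral_mono) auto
  also have "\<dots> = 1 / q * expectation (\<lambda>x. f x powr q) + (1 - 1 / q) * m powr q"
    using fq by (simp add: prob_space)
  also have "m * m powr (q - 1) = m powr q"
    using m q powr_mult_base[of m "q - 1"] by simp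
  finally have "m powr q \<le> expectation (\<lambda>x. f x powr q)"
    using q by (simp add: field_simps)
  then have "(m powr q) powr (1 / q) \<le> expectation (\<lambda>x. f x powr q) powr (1 / q)"
    using q by (intro powr_mono2) auto
  then show ?thesis
    using m q by (simp add: powr_powr m_def)
qed

section \<open>Lipschitz maps and the distance to a set\<close>

lemma infdist_1_lipschitz: "1-lipschitz_on T (\<lambda>x. infdist x S)"
  by (rule lipschitz_onI) (auto simp: dist_real_def infdist_triangle_abs)

lemma infdist_perturb:
  fixes x :: "'a::real_normed_vector"
  shows "infdist x S \<le> infdist y S + norm (y - x)"
  using infdist_triangle[of x S y] by (simp add: dist_norm norm_minus_commute)

lemma infdist_image_lipschitz:
  assumes "L-lipschitz_on A h" "L > 0" "x \<in> A" "S \<subseteq> A" "S \<noteq> {}"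
  shows "infdist (h x) (h ` S) \<le> L * infdist x S"
proof -
  have "infdist (h x) (h ` S) / L \<le> infdist x S"
  proof -
    have "infdist (h x) (h ` S) / L \<le> dist x s" if "s \<in> S" for s
    proof -
      have "infdist (h x) (h ` S) \<le> dist (h x) (h s)"
        using that by (intro infdist_le) auto
      also have "\<dots> \<le> L * dist x s"
        using assms that by (intro lipschitz_onD[OF assms(1)]) auto
      finally show ?thesis
        using assms by (simp add: field_simps)
    qed
    then show ?thesis
      using assms unfolding infdist_def by (auto intro!: cINF_greatest)
  qed
  then show ?thesis
    using assms by (simp add: field_simps)
qed

section \<open>Quantization error of the unit cube\<close>

lemma space_uniform_cube: "space uniform_cube = unit_cube"
  by (simp add: uniform_cube_def space_restrict_space)

lemma integrable_uniform_cube: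
  fixes f :: "real ^ 'k \<Rightarrow> real"
  assumes "continuous_on unit_cube f"
  shows "integrable uniform_cube f"
  using borel_integrable_compact[of unit_cube f] assms
  by (simp add: uniform_cube_def integrable_restrict_space unit_cube_def)

text \<open>A volume bound: the \<open>r\<close>-balls around the points of \<open>S\<close> have total volume at most \<open>1/2\<close> for
  the radius \<open>r\<close> below, so at least half of the cube is at distance at least \<open>r\<close> from \<open>S\<close>.\<close>

lemma quantization_error_unit_cube:
  fixes S :: "(real ^ 'd) set"
  assumes S: "finite S" "S \<noteq> {}" "card S \<le> n"
  defines "r \<equiv> (2 * unit_ball_vol (real CARD('d)) * real n) powr (- 1 / real CARD('d))"
  shows "r / 2 \<le> (\<integral>u. infdist u S \<partial>uniform_cube)"
proof -
  interpret U: prob_space "uniform_cube :: (real ^ 'd) measure"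
    by (rule prob_space_uniform_cube)
  define V where "V = unit_ball_vol (real CARD('d))"
  have V: "V > 0"
    by (simp add: V_def)
  have n: "n > 0"
    using S by (metis card_gt_0_iff le_zero_eq not_gr0)
  have r: "r > 0"
    using V n by (simp add: r_def flip: V_def)
  have "r ^ CARD('d) = r powr real CARD('d)"
    using r by (simp add: powr_realpow)
  also have "\<dots> = (2 * V * n) powr (- 1)"
    unfolding r_def V_def[symmetric] powr_powr by simp
  also have "\<dots> = 1 / (2 * V * n)"
    using V n by (simp add: powr_minus_divide)
  finally have rd: "r ^ CARD('d) = 1 / (2 * V * n)" .
  have meas: "(\<lambda>u. infdist u S) \<in> borel_measurable uniform_cube"
    by (intro borel_measurable_integrable integrable_uniform_cube continuous_intros)
  let ?near = "{u \<in> space uniform_cube. infdist u S < r}"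
  let ?far = "{u \<in> space uniform_cube. r \<le> infdist u S}"
  have near_sub: "?near \<subseteq> (\<Union>s\<in>S. ball s r)"
  proof
    fix u assume u: "u \<in> ?near"
    have "compact S"
      using S finite_imp_compact by blast
    then obtain s where "s \<in> S" "infdist u S = dist u s"
      using S infdist_attains_inf[of S u] by (auto simp: compact_imp_closed)
    then show "u \<in> (\<Union>s\<in>S. ball s r)"
      using u by (auto simp: dist_commute)
  qed
  have near_sets: "?near \<in> sets lborel"
  proof -
    have "?near = unit_cube \<inter> {u. infdist u S < r}"
      by (auto simp: space_uniform_cube)
    also have "\<dots> \<in> sets lborel"
      unfolding unit_cube_def
      by (intro sets.Int) (auto intro!: borel_open[OF open_Collect_less] continuous_intros)
    finally show ?thesis .
  qed
  have "U.prob ?near = measure lborel ?near"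
    unfolding uniform_cube_def
    by (rule measure_restrict_space) (auto simp: space_restrict_space unit_cube_def)
  also have "\<dots> \<le> measure lborel (\<Union>s\<in>S. ball s r)"
  proof (rule measure_mono_fmeasurable[OF near_sub near_sets])
    show "(\<Union>s\<in>S. ball s r) \<in> fmeasurable lborel"
      using S r by (intro fmeasurable.finite_UN) (auto simp: fmeasurable_def emeasure_ball)
  qed
  also have "\<dots> \<le> (\<Sum>s\<in>S. measure lborel (ball s r))"
    using S by (intro measure_UNION_le) auto
  also have "\<dots> = card S * (V * r ^ CARD('d))"
    using r by (simp add: content_ball V_def)
  also have "\<dots> \<le> n * (V * r ^ CARD('d))"
    using S V r by (intro mult_right_mono) auto
  also have "\<dots> = 1 / 2"
    using V n by (simp add: rd)
  finally have "U.prob ?near \<le> 1 / 2" .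
  moreover have "U.prob ?far = 1 - U.prob ?near"
  proof -
    have "?far = space uniform_cube - ?near"
      by auto
    then show ?thesis
      using meas by (simp add: U.prob_compl)
  qed
  ultimately have "1 / 2 \<le> U.prob ?far"
    by simp
  also have "\<dots> \<le> (\<integral>u. infdist u S \<partial>uniform_cube) / r"
    using r by (intro integral_Markov_inequality_measure[where A = "{}"]
        integrable_uniform_cube continuous_intros) (auto simp: infdist_nonneg)
  finally show ?thesis
    using r by (simp add: field_simps)
qed

section \<open>Wasserstein distance to an empirical distribution\<close>

lemma inverse_loss_eq_uniform_cube:
  "inverse_loss q g h = (\<integral>u. norm (h (g u) - u) powr q \<partial>uniform_cube)"
  by (simp add: inverse_loss_def uniform_cube_def integral_restrict_space
      set_lebesgue_integral_def unit_cube_def)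

lemma wasserstein1_nonneg: "wasserstein1 P Q \<ge> 0"
  unfolding wasserstein1_def
  by (rule SUP_upper2[where i = "\<lambda>_. 0"]) (auto intro: lipschitz_on_mono[OF lipschitz_on_constant])

lemma wasserstein1_empirical_ge:
  "wasserstein1 P (empirical n X) \<ge> ereal (\<integral>x. infdist x (X ` {1..n}) \<partial>P)"
proof -
  have X: "X \<in> measurable (uniform_count_measure {1..n}) borel"
    by (simp add: measurable_def space_uniform_count_measure sets_uniform_count_measure)
  have "(\<integral>x. infdist x (X ` {1..n}) \<partial>empirical n X)
      = (\<integral>i. infdist (X i) (X ` {1..n}) \<partial>uniform_count_measure {1..n})"
    unfolding empirical_def using X
    by (intro integral_distr borel_measurable_continuous_onI) (auto intro: continuous_intros)
  also have "\<dots> = (\<integral>i. 0 \<partial>uniform_count_measure {1..n})"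
    by (intro Bochner_Integration.integral_cong) (auto simp: space_uniform_count_measure)
  finally have "(\<integral>x. infdist x (X ` {1..n}) \<partial>empirical n X) = 0"
    by simp
  then show ?thesis
    unfolding wasserstein1_def
    by (intro SUP_upper2[where i = "\<lambda>x. infdist x (X ` {1..n})"])
       (auto simp: infdist_1_lipschitz)
qed

text \<open>The deterministic core of the result, valid for every generator \<open>g\<close> and every Lipschitz
  candidate \<open>h\<close> for its left inverse: \<open>h\<close> turns distances to the sample into distances to the \<open>n\<close>
  points \<open>h (X i)\<close>, at the price of the reconstruction error.\<close>

lemma wasserstein1_push_forward_ge:
  fixes X :: "nat \<Rightarrow> real ^ 'D" and h :: "real ^ 'D \<Rightarrow> real ^ 'd"
  assumes n: "n \<ge> 1" and q: "q \<ge> 1" and L: "L > 0"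
    and X: "\<And>i. i \<in> {1..n} \<Longrightarrow> X i \<in> unit_cube"
    and h: "h \<in> Lip L unit_cube unit_cube" and g: "g \<in> Lip K unit_cube unit_cube"
  defines "r \<equiv> (2 * unit_ball_vol (real CARD('d)) * real n) powr (- 1 / real CARD('d))"
  shows "ereal ((r / 2 - inverse_loss q g h powr (1 / q)) / L)
      \<le> wasserstein1 (push_forward g uniform_cube) (empirical n X)"
proof -
  interpret U: prob_space "uniform_cube :: (real ^ 'd) measure"
    by (rule prob_space_uniform_cube)
  define S where "S = X ` {1..n}"
  define err where "err u = norm (h (g u) - u)" for u
  have S: "finite S" "S \<noteq> {}" "S \<subseteq> unit_cube"
    using n X by (auto simp: S_def)
  have card: "card (h ` S) \<le> n"
    unfolding S_def image_image by (rule order.trans[OF card_image_le]) auto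
  have g_cont: "continuous_on unit_cube g" and g_into: "g ` unit_cube \<subseteq> unit_cube"
    using g by (auto simp: Lip_def intro: lipschitz_on_continuous_on)
  have h_lip: "L-lipschitz_on unit_cube h" and h_cont: "continuous_on unit_cube h"
    using h by (auto simp: Lip_def intro: lipschitz_on_continuous_on)
  have err_cont: "continuous_on unit_cube err"
    unfolding err_def using g_into
    by (intro continuous_intros continuous_on_compose2[OF h_cont g_cont])
  have errq_cont: "continuous_on unit_cube (\<lambda>u. err u powr q)"
    using q by (intro continuous_on_powr' err_cont continuous_intros) (auto simp: err_def)
  have dist_int: "integrable uniform_cube (\<lambda>u. infdist (g u) S)"
    by (intro integrable_uniform_cube continuous_intros g_cont)
  have "r / 2 \<le> (\<integral>u. infdist u (h ` S) \<partial>uniform_cube)"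
    unfolding r_def using S card by (intro quantization_error_unit_cube) auto
  also have "\<dots> \<le> (\<integral>u. L * infdist (g u) S + err u \<partial>uniform_cube)"
  proof (rule integral_mono)
    fix u :: "real ^ 'd" assume "u \<in> space uniform_cube"
    then have "infdist (h (g u)) (h ` S) \<le> L * infdist (g u) S"
      using S L g_into by (intro infdist_image_lipschitz[OF h_lip]) (auto simp: space_uniform_cube)
    then show "infdist u (h ` S) \<le> L * infdist (g u) S + err u"
      using infdist_perturb[of u "h ` S" "h (g u)"] by (simp add: err_def)
  qed (auto intro!: integrable_uniform_cube continuous_intros g_cont err_cont)
  also have "\<dots> = L * (\<integral>u. infdist (g u) S \<partial>uniform_cube) + U.expectation err"
    using dist_int integrable_uniform_cube[OF err_cont] by simp
  also have "U.expectation err \<le> U.expectation (\<lambda>u. err u powr q) powr (1 / q)"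
    using q by (intro U.expectation_le_powr_mean integrable_uniform_cube err_cont errq_cont)
      (auto simp: err_def)
  also have "U.expectation (\<lambda>u. err u powr q) = inverse_loss q g h"
    by (simp add: inverse_loss_eq_uniform_cube err_def)
  finally have "(r / 2 - inverse_loss q g h powr (1 / q)) / L
      \<le> (\<integral>u. infdist (g u) S \<partial>uniform_cube)"
    using L by (simp add: field_simps)
  also have "\<dots> = (\<integral>x. infdist x S \<partial>push_forward g uniform_cube)"
    unfolding push_forward_def
    by (intro integral_distr[symmetric] Lip_measurable_uniform_cube[OF g]
        borel_measurable_continuous_onI continuous_intros)
  finally have "ereal ((r / 2 - inverse_loss q g h powr (1 / q)) / L)
      \<le> ereal (\<integral>x. infdist x S \<partial>push_forward g uniform_cube)"
    by simp
  also have "\<dots> \<le> wasserstein1 (push_forward g uniform_cube) (empirical n X)"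
    unfolding S_def by (rule wasserstein1_empirical_ge)
  finally show ?thesis .
qed

section \<open>Penalized near-minimizers\<close>

lemma pen_attained:
  assumes "has_minimum (inverse_loss q g) H"
  obtains h where "h \<in> H" "pen q H g = inverse_loss q g h"
proof -
  obtain h where h: "h \<in> H" "\<forall>k\<in>H. inverse_loss q g h \<le> inverse_loss q g k"
    using assms by (auto simp: has_minimum_def)
  then have "pen q H g = inverse_loss q g h"
    unfolding pen_def by (intro cInf_eq_minimum) auto
  then show thesis
    using h that by blast
qed

text \<open>A near-minimizer competes with the elements of zero penalty, for which the objective is the
  Wasserstein distance alone.\<close>

lemma pen_near_minimizer:
  assumes "objective q lam H P g0 \<le> (INF g\<in>G. objective q lam H P g) + ereal \<epsilon>"
  shows "ereal (lam * pen q H g0)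
      \<le> (INF g\<in>{g \<in> G. pen q H g = 0}. wasserstein1 (push_forward g uniform_cube) P) + ereal \<epsilon>"
proof -
  have "ereal (lam * pen q H g0) \<le> objective q lam H P g0"
    unfolding objective_def by (rule add_increasing) (auto simp: wasserstein1_nonneg)
  also note assms
  also have "(INF g\<in>G. objective q lam H P g) + ereal \<epsilon>
      \<le> (INF g\<in>{g \<in> G. pen q H g = 0}. wasserstein1 (push_forward g uniform_cube) P) + ereal \<epsilon>"
    by (intro add_right_mono INF_superset_mono) (auto simp: objective_def)
  finally show ?thesis .
qed

theorem theorem1:
  fixes n :: nat and q L\<^sub>H L\<^sub>G lam \<epsilon> :: real
    and X :: "nat \<Rightarrow> real ^ 'D"
    and H :: "(real ^ 'D \<Rightarrow> real ^ 'd) set"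
    and G :: "(real ^ 'd \<Rightarrow> real ^ 'D) set"
    and g_hat :: "real ^ 'd \<Rightarrow> real ^ 'D"
  assumes "n \<ge> 1" and "q \<ge> 1" and "L\<^sub>H > 0" and "L\<^sub>G > 0" and "lam > 0" and "\<epsilon> > 0"
    and "\<And>i. i \<in> {1..n} \<Longrightarrow> X i \<in> unit_cube"
    and "H \<subseteq> Lip L\<^sub>H unit_cube unit_cube"
    and "G \<subseteq> Lip L\<^sub>G unit_cube unit_cube"
    and "\<And>g. g \<in> G \<Longrightarrow> has_minimum (inverse_loss q g) H"
    and "has_minimum (objective q lam H (empirical n X)) G"
    and "g_hat \<in> G"
    and "objective q lam H (empirical n X) g_hat
           \<le> (INF g\<in>G. objective q lam H (empirical n X) g) + ereal \<epsilon>"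
  shows "wasserstein1 (push_forward g_hat uniform_cube) (empirical n X)
      \<ge> ereal (1 / (2 * L\<^sub>H *
            (1 + (2 * unit_ball_vol (real CARD('d)) * real n) powr (1 / real CARD('d)))))
        - ereal (1 / (L\<^sub>H * lam powr (1 / q))) *
          ereal_powr
            ((INF g\<in>{g \<in> G. pen q H g = 0}.
                wasserstein1 (push_forward g uniform_cube) (empirical n X)) + ereal \<epsilon>)
            (1 / q)"
proof -
  define W where "W = wasserstein1 (push_forward g_hat uniform_cube) (empirical n X)"
  define I where "I = (INF g\<in>{g \<in> G. pen q H g = 0}.
      wasserstein1 (push_forward g uniform_cube) (empirical n X)) + ereal \<epsilon>"
  define R where "R = (2 * unit_ball_vol (real CARD('d)) * real n) powr (1 / real CARD('d))"
  define p where "p = pen q H g_hat"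
  have R: "R > 0"
    using \<open>n \<ge> 1\<close> unit_ball_vol_pos[of "real CARD('d)"]
    unfolding R_def by (auto simp del: unit_ball_vol_pos)
  obtain h where h: "h \<in> H" "p = inverse_loss q g_hat h"
    using pen_attained assms(10)[OF \<open>g_hat \<in> G\<close>] unfolding p_def by blast
  have p: "p \<ge> 0"
    using h by (simp add: inverse_loss_eq_uniform_cube)
  have lip: "h \<in> Lip L\<^sub>H unit_cube unit_cube" "g_hat \<in> Lip L\<^sub>G unit_cube unit_cube"
    using assms(8,9,12) h by auto
  have "ereal ((1 / R / 2 - p powr (1 / q)) / L\<^sub>H) \<le> W"
    using wasserstein1_push_forward_ge[OF assms(1-3,7) lip]
    by (simp add: W_def h(2) R_def powr_minus_divide)
  moreover have "1 / (2 * L\<^sub>H * (1 + R)) \<le> 1 / R / 2 / L\<^sub>H"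
    using R \<open>L\<^sub>H > 0\<close> by (simp add: frac_le)
  ultimately have W: "ereal (1 / (2 * L\<^sub>H * (1 + R)) - p powr (1 / q) / L\<^sub>H) \<le> W"
    by (elim order.trans[rotated]) (simp add: diff_divide_distrib)
  have pI: "ereal (lam * p) \<le> I"
    unfolding p_def I_def by (rule pen_near_minimizer) (fact assms(13))
  have "ereal (1 / (2 * L\<^sub>H * (1 + R)))
      - ereal (1 / (L\<^sub>H * lam powr (1 / q))) * ereal_powr I (1 / q) \<le> W"
  proof (cases I)
    case PInf
    \<comment> \<open>No generator of zero penalty is at finite distance from the data: the bound is \<open>-\<infinity>\<close>.\<close>
    then show ?thesis
      using \<open>L\<^sub>H > 0\<close> \<open>lam > 0\<close> by (simp add: ereal_powr_def)
  next
    case MInf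
    then show ?thesis
      using pI by simp
  next
    case (real t)
    have "p powr (1 / q) \<le> (t / lam) powr (1 / q)"
      using pI real p \<open>lam > 0\<close> \<open>q \<ge> 1\<close> by (intro powr_mono2) (auto simp: field_simps)
    also have "\<dots> = t powr (1 / q) / lam powr (1 / q)"
    proof -
      have "0 \<le> lam * p"
        using p \<open>lam > 0\<close> by simp
      then have "t \<ge> 0"
        using pI real by simp
      then show ?thesis
        using \<open>lam > 0\<close> by (simp add: powr_divide)
    qed
    finally have "p powr (1 / q) / L\<^sub>H \<le> 1 / (L\<^sub>H * lam powr (1 / q)) * t powr (1 / q)"
      using \<open>L\<^sub>H > 0\<close> by (simp add: field_simps)
    then have "ereal (1 / (2 * L\<^sub>H * (1 + R)) - 1 / (L\<^sub>H * lam powr (1 / q)) * t powr (1 / q))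
        \<le> ereal (1 / (2 * L\<^sub>H * (1 + R)) - p powr (1 / q) / L\<^sub>H)"
      by simp
    also note W
    finally show ?thesis
      using real by (simp add: ereal_powr_def)
  qed
  then show ?thesis
    by (simp add: W_def I_def R_def)
qed

end
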